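(* Let $C:\mathbb{R}\to[1,\infty)$ be continuously differentiable and let $\widetilde C:[0,1]\to[0,1]$ be a moderation incentive with moderation potential $\chi:\mathbb{R}\to[0,\infty)$. Let $x_0,x_f,v_0,v_f\in\mathbb{R}$ and let $\lambda_0\neq\lambda_f$ be real numbers; let $[\lambda_0,\lambda_f]$ denote the closed interval with endpoints $\lambda_0$ and $\lambda_f$ (whichever is larger). Suppose that (i) there are functions $r:[\lambda_0,\lambda_f]\to\mathbb{R}$ and $q:[\lambda_0,\lambda_f]\to\mathbb{R}^+$ satisfying the evolution equations $$q\,r' + C\circ r-\chi=\text{constant}\qquad\text{and}\qquad q'=-2\,C'(r)$$ on $[\lambda_0,\lambda_f]$ (where $'$ denotes the derivative with respect to $\lambda$ for $r$ and $q$), and the boundary conditions $r(\lambda_0)=x_0$, $r(\lambda_f)=x_f$, $\sqrt{q(\lambda_0)}\,r'(\lambda_0)=v_0\,\mathrm{sgn}(\lambda_f-\lambda_0)$, and $\sqrt{q(\lambda_f)}\,r'(\lambda_f)=v_f\,\mathrm{sgn}(\lambda_f-\lambda_0)$; (ii) the solution $\lambda(t)$ of the initial value problem $$\dot\lambda=\mathrm{sgn}(\lambda_f-\lambda_0)\sqrt{q(\lambda)},\qquad \lambda(0)=\lambda_0,$$ passes through $\lambda_f$ at some positive time $t_f$. Then $x=r\circ\lambda:[0,t_f]\to\mathbb{R}$ is a solution of the one dimensional controlled acceleration synthesis problem (the second order synthesis problem in $\mathbb{R}$ for the cost function $C(x)-\widetilde C(|u|)$) with boundary data $x(0)=x_0$,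 $x(t_f)=x_f$, $\dot x(0)=v_0$, and $\dot x(t_f)=v_f$. If the constant in (i) is zero, then $x$ is a solution of the arbitrary duration synthesis problem.
   Context: $\mathbb{R}^+=(0,\infty)$. Moderation incentive: a continuous function $\widetilde C:[0,1]\to[0,1]$, differentiable on $(0,1)$, with $\widetilde C(1)=0$, such that there is a unique non-decreasing continuous function $\sigma:\mathbb{R}^+\to(0,1]$, differentiable on $\sigma^{-1}((0,1))$, satisfying $$\sigma(s)\,s+\widetilde C(\sigma(s))=\widetilde\chi(s):=\max_{0\le \varsigma\le 1}\big(\varsigma\, s+\widetilde C(\varsigma)\big)\quad\text{for all } s>0.$$ Its moderation potential on $\mathbb{R}$ is $\chi(\lambda):=\widetilde\chi(|\lambda|)$ (with $\widetilde\chi(0)$ given by the same maximum). Synthesis problem (second order, in $\mathbb{R}$) for the cost function $C(x)-\widetilde C(|u|)$ with control $u=\ddot x$, $|u|\le 1$: given boundary values for $x(0),\dot x(0),x(t_f),\dot x(t_f)$, a function $x\in\mathcal{C}^1([0,t_f],\mathbb{R})$ with piecewise continuous second derivative, $|\ddot x|\le 1$, satisfying the boundary conditions is a solution of the synthesis problem if there exists $\lambda:[0,t_f]\to\mathbb{R}$ such that for $0\le t\le t_f$ $$\ddot\lambda=-C'(x),\qquad |\ddot x|\,|\lambda|+\widetilde C(|\ddot x|)=\chi(\lambda),\qquad |\lambda|\,\ddot x=|\ddot x|\,\lambda .$$ If $\ddot x$ is discontinuous at $t_*$, then $\ddot x(t_* )$ is taken to be the left-hand limit $\lim_{t\to t_*^-}\ddot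 x(t)$. If, in addition, $\chi(\lambda)-C(x)-\dot x\,\dot\lambda$ equals zero along the curve $(x,\lambda)$, then $x$ is a solution of the synthesis problem of arbitrary duration. *)

theory Defs
  imports "HOL-Analysis.Analysis"
begin

definition max_moderated :: "(real \<Rightarrow> real) \<Rightarrow> real \<Rightarrow> real" where
  "max_moderated Ct s = (SUP \<zeta>\<in>{0..1}. \<zeta> * s + Ct \<zeta>)"

text \<open>For continuous \<open>Ct\<close> the supremum is a maximum.\<close>

lemma max_moderated_is_max:
  assumes "continuous_on {0..1} Ct"
  shows "\<exists>\<zeta>\<in>{0..1}. max_moderated Ct s = \<zeta> * s + Ct \<zeta> \<and>
           (\<forall>\<xi>\<in>{0..1}. \<xi> * s + Ct \<xi> \<le> \<zeta> * s + Ct \<zeta>)"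
proof -
  have "continuous_on {0..1} (\<lambda>\<zeta>. \<zeta> * s + Ct \<zeta>)"
    by (intro continuous_intros assms)
  then obtain \<zeta> where \<zeta>: "\<zeta> \<in> {0..1}" "\<forall>\<xi>\<in>{0..1}. \<xi> * s + Ct \<xi> \<le> \<zeta> * s + Ct \<zeta>"
    using continuous_attains_sup[of "{0..1::real}" "\<lambda>\<zeta>. \<zeta> * s + Ct \<zeta>"] by auto
  then have "max_moderated Ct s = \<zeta> * s + Ct \<zeta>"
    unfolding max_moderated_def by (intro cSup_eq_maximum) auto
  with \<zeta> show ?thesis by blast
qed

text \<open>
  The functions \<open>\<sigma>\<close> on the positive reals are represented by their extensional
  versions, so that \<open>\<exists>!\<close> expresses uniqueness on the positive reals only.
\<close>

definition moderation_incentive :: "(real \<Rightarrow> real) \<Rightarrow> bool" where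
  "moderation_incentive Ct \<longleftrightarrow>
     Ct \<in> {0..1} \<rightarrow> {0..1} \<and>
     continuous_on {0..1} Ct \<and>
     Ct differentiable_on {0<..<1} \<and>
     Ct 1 = 0 \<and>
     (\<exists>!\<sigma>. \<sigma> \<in> {0<..} \<rightarrow>\<^sub>E {0<..1} \<and>
           mono_on {0<..} \<sigma> \<and>
           continuous_on {0<..} \<sigma> \<and>
           \<sigma> differentiable_on {s \<in> {0<..}. \<sigma> s \<in> {0<..<1}} \<and>
           (\<forall>s>0. \<sigma> s * s + Ct (\<sigma> s) = max_moderated Ct s))"

definition moderation_potential :: "(real \<Rightarrow> real) \<Rightarrow> real \<Rightarrow> real" where
  "moderation_potential Ct l = max_moderated Ct \<bar>l\<bar>"

text \<open>
  On \<open>[0, T]\<close>, the function \<open>v\<close> is the continuous first derivative of \<open>x\<close>, and \<open>u\<close> its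
  piecewise continuous second derivative: away from finitely many interior times, \<open>u\<close> is
  the derivative of \<open>v\<close> and is continuous; at the exceptional times it has one-sided limits
  and takes the left-hand one as its value. At \<open>0\<close> and \<open>T\<close> derivatives are one-sided.
  These conditions determine \<open>v\<close> and \<open>u\<close> on \<open>[0, T]\<close>.
\<close>

definition C1_piecewise_C2 ::
  "real \<Rightarrow> (real \<Rightarrow> real) \<Rightarrow> (real \<Rightarrow> real) \<Rightarrow> (real \<Rightarrow> real) \<Rightarrow> bool" where
  "C1_piecewise_C2 T x v u \<longleftrightarrow>
     (\<forall>t\<in>{0..T}. (x has_real_derivative v t) (at t within {0..T})) \<and>
     continuous_on {0..T} v \<and>
     (\<exists>S. finite S \<and> S \<subseteq> {0<..<T} \<and>
          (\<forall>t\<in>{0..T} - S. (v has_real_derivative u t) (at t within {0..T})) \<and>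
          continuous_on ({0..T} - S) u \<and>
          (\<forall>t\<in>S. (u \<longlongrightarrow> u t) (at_left t) \<and> (\<exists>l. (u \<longlongrightarrow> l) (at_right t))))"

text \<open>
  \<open>v\<close>, \<open>u\<close> are the first and second derivatives of \<open>x\<close>, and \<open>m\<close> is the first derivative of \<open>l\<close>.
\<close>

definition synthesis_curve ::
  "(real \<Rightarrow> real) \<Rightarrow> (real \<Rightarrow> real) \<Rightarrow> real \<Rightarrow>
   (real \<Rightarrow> real) \<Rightarrow> (real \<Rightarrow> real) \<Rightarrow> (real \<Rightarrow> real) \<Rightarrow>
   (real \<Rightarrow> real) \<Rightarrow> (real \<Rightarrow> real) \<Rightarrow> bool" where
  "synthesis_curve C Ct T x v u l m \<longleftrightarrow>
     0 < T \<and>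
     C1_piecewise_C2 T x v u \<and>
     (\<forall>t\<in>{0..T}.
        \<bar>u t\<bar> \<le> 1 \<and>
        (l has_real_derivative m t) (at t within {0..T}) \<and>
        (m has_real_derivative - deriv C (x t)) (at t within {0..T}) \<and>
        \<bar>u t\<bar> * \<bar>l t\<bar> + Ct \<bar>u t\<bar> = moderation_potential Ct (l t) \<and>
        \<bar>l t\<bar> * u t = \<bar>u t\<bar> * l t)"

definition synthesis_solution ::
  "(real \<Rightarrow> real) \<Rightarrow> (real \<Rightarrow> real) \<Rightarrow> real \<Rightarrow> real \<Rightarrow> real \<Rightarrow> real \<Rightarrow> real \<Rightarrow>
   (real \<Rightarrow> real) \<Rightarrow> bool" where
  "synthesis_solution C Ct T x0 xf v0 vf x \<longleftrightarrow>
     (\<exists>v u l m. synthesis_curve C Ct T x v u l m \<and>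
        x 0 = x0 \<and> x T = xf \<and> v 0 = v0 \<and> v T = vf)"

definition arbitrary_duration_synthesis_solution ::
  "(real \<Rightarrow> real) \<Rightarrow> (real \<Rightarrow> real) \<Rightarrow> real \<Rightarrow> real \<Rightarrow> real \<Rightarrow> real \<Rightarrow> real \<Rightarrow>
   (real \<Rightarrow> real) \<Rightarrow> bool" where
  "arbitrary_duration_synthesis_solution C Ct T x0 xf v0 vf x \<longleftrightarrow>
     (\<exists>v u l m. synthesis_curve C Ct T x v u l m \<and>
        x 0 = x0 \<and> x T = xf \<and> v 0 = v0 \<and> v T = vf \<and>
        (\<forall>t\<in>{0..T}. moderation_potential Ct (l t) - C (x t) - v t * m t = 0))"

end

theory Submission imports Defs begin

text \<open>
  Put \<open>\<epsilon> = sgn (lf - l0)\<close> and \<open>m = \<epsilon> * sqrt (q \<circ> l)\<close>, the derivative of \<open>l\<close>, and write \<open>\<chi>\<close>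
  for \<open>moderation_potential Ct\<close>. Because \<open>q\<close> evolves by \<open>-2 * C'(r)\<close>, the derivative of \<open>m\<close> is \<open>-C'(x)\<close> for \<open>x = r \<circ> l\<close>. The velocity
  \<open>v = r'(l) * m\<close> then satisfies \<open>v * m = q(l) * r'(l) = c + \<chi>(l) - C(x)\<close>, by the other
  evolution equation. This conservation law does two things: for \<open>c = 0\<close> it is the condition of
  arbitrary duration, and, since \<open>m\<close> never vanishes, it can be differentiated after division by
  \<open>m\<close>. The two terms with \<open>C'(x)\<close> then cancel and \<open>x'' = \<chi>'(l)\<close> remains
  (\<open>conservation_law_derivative\<close>).

  It remains to understand \<open>\<chi>'\<close>. On the half-line of nonnegative arguments, \<open>max_moderated Ct\<close> is
  a supremum of affine functions with a continuous choice \<open>\<sigma>\<close> of maximizers (the maximizer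
  extends to \<open>0\<close> by monotonicity), so its derivative is \<open>\<sigma>\<close>: this is the envelope theorem
  (\<open>moderation_incentive_level\<close> and \<open>max_moderated_envelope\<close>). Hence
  \<open>x'' = \<plusminus>\<sigma> \<bar>l\<bar>\<close> with the sign of \<open>l\<close>, which is exactly the optimality condition on the control.
  The potential may have a corner at \<open>0\<close>, but \<open>l\<close> is strictly monotone and so crosses \<open>0\<close> at
  most once (\<open>strict_mono_sign_selector\<close>); this crossing is the only possible
  discontinuity of the control.
\<close>

section \<open>The envelope theorem for the moderation potential\<close>

text \<open>
  The difference quotient at \<open>s\<close> with second point \<open>y\<close> lies between \<open>\<sigma> s\<close> and \<open>\<sigma> y\<close>, as the
  subgradient inequality can be read from either end.
\<close>

lemma continuous_subgradient_imp_derivative: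
  fixes F \<sigma> :: "real \<Rightarrow> real"
  assumes sub: "\<And>s y. s \<in> A \<Longrightarrow> y \<in> A \<Longrightarrow> \<sigma> s * (y - s) \<le> F y - F s"
    and cont: "continuous_on A \<sigma>" and s: "s \<in> A"
  shows "(F has_real_derivative \<sigma> s) (at s within A)"
proof -
  have bound: "norm ((F y - F s) / (y - s) - \<sigma> s) \<le> \<bar>\<sigma> y - \<sigma> s\<bar>"
    if y: "y \<in> A" "y \<noteq> s" for y
  proof -
    have lower: "\<sigma> s * (y - s) \<le> F y - F s" and upper: "F y - F s \<le> \<sigma> y * (y - s)"
      using sub[OF s y(1)] sub[OF y(1) s] by (auto simp: algebra_simps)
    show ?thesis
    proof (cases "s < y")
      case True
      then have "\<sigma> s \<le> (F y - F s) / (y - s)" "(F y - F s) / (y - s) \<le> \<sigma> y"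
        using lower upper by (simp_all add: pos_le_divide_eq pos_divide_le_eq)
      then show ?thesis by simp
    next
      case False
      then have "y - s < 0" using y by simp
      then have "\<sigma> y \<le> (F y - F s) / (y - s)" "(F y - F s) / (y - s) \<le> \<sigma> s"
        using lower upper by (simp_all add: neg_le_divide_eq neg_divide_le_eq)
      then show ?thesis by simp
    qed
  qed
  have "(\<sigma> \<longlongrightarrow> \<sigma> s) (at s within A)"
    using cont s by (simp add: continuous_on)
  then have "((\<lambda>y. \<bar>\<sigma> y - \<sigma> s\<bar>) \<longlongrightarrow> 0) (at s within A)"
    by (simp add: LIM_zero_iff tendsto_rabs_zero_iff)
  then have "((\<lambda>y. (F y - F s) / (y - s) - \<sigma> s) \<longlongrightarrow> 0) (at s within A)"
    by (rule Lim_null_comparison[rotated]) (use bound in \<open>auto simp: eventually_at_filter\<close>)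
  then show ?thesis
    by (simp add: has_field_derivative_iff LIM_zero_iff)
qed

lemma mono_on_tendsto_Inf_at_right:
  fixes f :: "real \<Rightarrow> real"
  assumes mono: "mono_on {a<..} f" and bdd: "bdd_below (f ` {a<..})"
  shows "(f \<longlongrightarrow> (INF s\<in>{a<..}. f s)) (at_right a)"
proof (rule order_tendstoI)
  fix b assume "b < (INF s\<in>{a<..}. f s)"
  then have "b < f s" if "a < s" for s
    using cINF_lower[OF bdd, of s] that by simp
  then show "\<forall>\<^sub>F s in at_right a. b < f s"
    by (auto simp: eventually_at_filter)
next
  fix b assume "(INF s\<in>{a<..}. f s) < b"
  then obtain z where z: "a < z" "f z < b"
    using bdd by (subst (asm) cINF_less_iff) auto
  have "f s < b" if "a < s" "s < z" for s
    using mono_onD[OF mono, of s z] that z by auto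
  then show "\<forall>\<^sub>F s in at_right a. f s < b"
    using z(1) by (auto simp: eventually_at_right)
qed

lemma max_moderated_upper:
  assumes "continuous_on {0..1} Ct" "\<zeta> \<in> {0..1}"
  shows "\<zeta> * s + Ct \<zeta> \<le> max_moderated Ct s"
  using max_moderated_is_max[OF assms(1), of s] assms(2) by auto

text \<open>
  The moderation level at \<open>0\<close> is the limit from the right: the inequalities expressing
  maximality at \<open>s > 0\<close> are closed conditions and survive the limit.
\<close>

lemma moderation_incentive_level:
  assumes Ct: "moderation_incentive Ct"
  obtains \<sigma> where "continuous_on {0..} \<sigma>" "\<And>s. 0 \<le> s \<Longrightarrow> \<sigma> s \<in> {0..1}"
    "\<And>s. 0 \<le> s \<Longrightarrow> \<sigma> s * s + Ct (\<sigma> s) = max_moderated Ct s"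
proof -
  have contC: "continuous_on {0..1} Ct"
    using Ct by (simp add: moderation_incentive_def)
  from Ct obtain \<sigma>
    where range: "\<sigma> \<in> {0<..} \<rightarrow>\<^sub>E {0<..1}" and mono: "mono_on {0<..} \<sigma>"
      and cont: "continuous_on {0<..} \<sigma>"
      and opt: "\<And>s. s > 0 \<Longrightarrow> \<sigma> s * s + Ct (\<sigma> s) = max_moderated Ct s"
    unfolding moderation_incentive_def by blast
  have pos: "0 < \<sigma> s" "\<sigma> s \<le> 1" if "0 < s" for s
    using range that by (auto simp: PiE_def Pi_def)
  define L where "L = (INF s\<in>{0<..}. \<sigma> s)"
  have bdd: "bdd_below (\<sigma> ` {0<..})"
    using pos by (intro bdd_belowI2[where m = 0]) (auto intro: less_imp_le)
  have lim: "(\<sigma> \<longlongrightarrow> L) (at_right 0)"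
    unfolding L_def by (rule mono_on_tendsto_Inf_at_right[OF mono bdd])
  have right: "\<forall>\<^sub>F s in at_right (0::real). 0 < s"
    by (simp add: eventually_at_filter)
  have ev: "\<forall>\<^sub>F s in at_right 0. \<sigma> s \<in> {0..1}"
    using right by eventually_elim (use pos in force)
  have L: "L \<in> {0..1}"
    by (rule Lim_in_closed_set[OF _ ev _ lim]) auto
  have lim_Ct: "((\<lambda>s. Ct (\<sigma> s)) \<longlongrightarrow> Ct L) (at_right 0)"
    by (rule continuous_on_tendsto_compose[OF contC lim L ev])
  have L_max: "\<zeta> * 0 + Ct \<zeta> \<le> L * 0 + Ct L" if "\<zeta> \<in> {0..1}" for \<zeta>
  proof (rule tendsto_le)
    show "((\<lambda>s. \<sigma> s * s + Ct (\<sigma> s)) \<longlongrightarrow> L * 0 + Ct L) (at_right 0)"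
      by (intro tendsto_intros lim lim_Ct)
    show "((\<lambda>s. \<zeta> * s + Ct \<zeta>) \<longlongrightarrow> \<zeta> * 0 + Ct \<zeta>) (at_right 0)"
      by (intro tendsto_intros)
    show "\<forall>\<^sub>F s in at_right 0. \<zeta> * s + Ct \<zeta> \<le> \<sigma> s * s + Ct (\<sigma> s)"
      using right by eventually_elim (simp add: opt max_moderated_upper[OF contC that])
  qed simp
  have opt0: "L * 0 + Ct L = max_moderated Ct 0"
    using max_moderated_is_max[OF contC, of 0] L_max L by force
  define \<tau> where "\<tau> s = (if s \<le> 0 then L else \<sigma> s)" for s
  have cont\<tau>: "continuous_on {0..} \<tau>"
    unfolding continuous_on_def
  proof
    fix s :: real assume s: "s \<in> {0..}"
    show "(\<tau> \<longlongrightarrow> \<tau> s) (at s within {0..})"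
    proof (cases "s = 0")
      case True
      have eq: "at (0::real) within {0..} = at_right 0"
        by (intro at_within_nhd[of _ UNIV]) auto
      show ?thesis unfolding True eq
        by (rule Lim_transform_eventually[OF _ eventually_mono[OF right]])
          (use lim in \<open>auto simp: \<tau>_def\<close>)
    next
      case False
      with s have "0 < s" by simp
      then have "(\<sigma> \<longlongrightarrow> \<sigma> s) (at s)"
        using cont by (simp add: continuous_on_eq_continuous_at isCont_def)
      moreover have "\<forall>\<^sub>F y in at s. \<sigma> y = \<tau> y"
        using eventually_at_in_open'[of "{0<..}" s] \<open>0 < s\<close>
        by (auto elim!: eventually_mono simp: \<tau>_def)
      ultimately have "(\<tau> \<longlongrightarrow> \<sigma> s) (at s)"
        by (rule Lim_transform_eventually)
      then show ?thesis
        using \<open>0 < s\<close> by (auto simp: \<tau>_def intro: tendsto_within_subset)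
    qed
  qed
  show thesis
  proof (rule that[OF cont\<tau>])
    fix s :: real assume "0 \<le> s"
    then show "\<tau> s \<in> {0..1}" "\<tau> s * s + Ct (\<tau> s) = max_moderated Ct s"
      using L pos[of s] opt[of s] opt0 by (auto simp: \<tau>_def)
  qed
qed

lemma max_moderated_envelope:
  assumes contC: "continuous_on {0..1} Ct" and cont: "continuous_on {0..} \<sigma>"
    and range: "\<And>s. 0 \<le> s \<Longrightarrow> \<sigma> s \<in> {0..1}"
    and opt: "\<And>s. 0 \<le> s \<Longrightarrow> \<sigma> s * s + Ct (\<sigma> s) = max_moderated Ct s"
    and s: "0 \<le> s"
  shows "(max_moderated Ct has_real_derivative \<sigma> s) (at s within {0..})"
proof (rule continuous_subgradient_imp_derivative[OF _ cont])
  fix s y :: real assume "s \<in> {0..}" "y \<in> {0..}"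
  \<comment> \<open>The maximizer at \<open>s\<close> is one competitor in the maximum at \<open>y\<close>.\<close>
  then show "\<sigma> s * (y - s) \<le> max_moderated Ct y - max_moderated Ct s"
    using opt[of s] max_moderated_upper[OF contC range[of s], of y] by (simp add: algebra_simps)
qed (use s in simp)

section \<open>Sign changes of the multiplier\<close>

text \<open>
  The function \<open>\<eta>\<close> is a sign of \<open>y\<close> in which the ambiguity at a zero is resolved from the left
  at an interior zero, as the convention for the control demands, and from inside the interval
  at an endpoint. Only an interior zero makes \<open>\<eta>\<close> jump.
\<close>

lemma strict_mono_sign_selector:
  fixes y :: "real \<Rightarrow> real"
  assumes cont: "continuous_on {0..T} y" and mono: "strict_mono_on {0..T} y" and T: "0 < T"
  obtains \<eta> :: "real \<Rightarrow> real" and S where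
    "\<And>t. \<bar>\<eta> t\<bar> = 1" "\<And>t. t \<in> {0..T} \<Longrightarrow> \<eta> t * y t = \<bar>y t\<bar>"
    "finite S" "S \<subseteq> {0<..<T}"
    "\<And>t. t \<in> {0..T} - S \<Longrightarrow> \<forall>\<^sub>F s in at t within {0..T}. \<eta> s = \<eta> t"
    "\<And>t. t \<in> S \<Longrightarrow> \<forall>\<^sub>F s in at_left t. \<eta> s = \<eta> t"
    "\<And>t. t \<in> S \<Longrightarrow> \<exists>e. \<forall>\<^sub>F s in at_right t. \<eta> s = e"
proof -
  have le: "y s \<le> y t" if "s \<in> {0..T}" "t \<in> {0..T}" "s \<le> t" for s t
    using strict_mono_onD[OF mono, of s t] that by (cases "s = t") auto
  consider "0 \<le> y 0" | "y T \<le> 0" | "y 0 < 0" "0 < y T" by linarith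
  then show thesis
  proof cases
    case 1
    then have "0 \<le> y t" if "t \<in> {0..T}" for t using le[of 0 t] that by auto
    then show thesis by (intro that[of "\<lambda>_. 1" "{}"]) auto
  next
    case 2
    then have "y t \<le> 0" if "t \<in> {0..T}" for t using le[of t T] that by auto
    then show thesis by (intro that[of "\<lambda>_. -1" "{}"]) auto
  next
    case 3
    then obtain z where z: "0 \<le> z" "z \<le> T" "y z = 0"
      using IVT'[of y 0 0 T] cont T by auto
    with 3 have zT: "0 < z" "z < T" by (auto simp: less_le)
    define \<eta> :: "real \<Rightarrow> real" where "\<eta> t = (if t \<le> z then -1 else 1)" for t
    show thesis
    proof (rule that[of \<eta> "{z}"])
      show "\<eta> t * y t = \<bar>y t\<bar>" if "t \<in> {0..T}" for t
        using le[of t z] le[of z t] that z by (auto simp: \<eta>_def)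
      show "\<forall>\<^sub>F s in at t within {0..T}. \<eta> s = \<eta> t" if "t \<in> {0..T} - {z}" for t
      proof (cases "t < z")
        case True
        then have "\<forall>\<^sub>F s in nhds t. s < z" by (auto intro: order_tendstoD filterlim_ident)
        then show ?thesis
          using True by (auto simp: eventually_at_filter \<eta>_def elim!: eventually_mono)
      next
        case False
        with that have "z < t" by auto
        then have "\<forall>\<^sub>F s in nhds t. z < s" by (auto intro: order_tendstoD filterlim_ident)
        then show ?thesis
          using \<open>z < t\<close> by (auto simp: eventually_at_filter \<eta>_def elim!: eventually_mono)
      qed
      show "\<exists>e. \<forall>\<^sub>F s in at_right t. \<eta> s = e" if "t \<in> {z}" for t
        using that by (intro exI[of _ 1]) (auto simp: \<eta>_def eventually_at_filter)
    qed (use zT in \<open>auto simp: \<eta>_def eventually_at_filter\<close>)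
  qed
qed

section \<open>The synthesis curve\<close>

text \<open>
  Dividing the conservation law \<open>v * m = c + \<chi> - C\<close> by \<open>m\<close> and differentiating, the two
  contributions of \<open>C'(x)\<close>, one through \<open>x\<close> and one through \<open>m\<close>, cancel.
\<close>

lemma conservation_law_derivative:
  fixes C P x v m :: "real \<Rightarrow> real"
  assumes law: "\<And>s. s \<in> A \<Longrightarrow> v s * m s = c + P s - C (x s)"
    and nz: "\<And>s. s \<in> A \<Longrightarrow> m s \<noteq> 0" and t: "t \<in> A"
    and dx: "(x has_real_derivative v t) (at t within A)"
    and dm: "(m has_real_derivative - C') (at t within A)"
    and dC: "(C has_real_derivative C') (at (x t))"
    and dP: "(P has_real_derivative w * m t) (at t within A)"
  shows "(v has_real_derivative w) (at t within A)"
proof -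
  have dCx: "((\<lambda>s. C (x s)) has_real_derivative C' * v t) (at t within A)"
    by (rule DERIV_chain2[OF dC dx])
  have "((\<lambda>s. (c + P s - C (x s)) / m s) has_real_derivative
      ((0 + w * m t - C' * v t) * m t - (c + P t - C (x t)) * (- C')) / (m t * m t))
      (at t within A)"
    by (intro DERIV_divide DERIV_add DERIV_diff DERIV_const dCx dP dm nz[OF t])
  also have "((0 + w * m t - C' * v t) * m t - (c + P t - C (x t)) * (- C')) / (m t * m t) = w"
    using nz[OF t] unfolding law[OF t, symmetric] by (simp add: field_simps)
  finally show ?thesis
  proof (rule has_field_derivative_transform_within[OF _ zero_less_one t])
    fix s assume "s \<in> A"
    then show "(c + P s - C (x s)) / m s = v s"
      using law[of s] nz[of s] by (simp add: field_simps)
  qed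
qed

text \<open>
  Differentiating \<open>\<epsilon> * sqrt (q \<circ> l)\<close> brings down \<open>1 / (2 * sqrt (q \<circ> l))\<close>, which cancels the
  speed of \<open>l\<close>: half the rate of change of \<open>q\<close> per unit of \<open>l\<close> becomes an acceleration in time.
\<close>

lemma ode_speed_derivative:
  fixes l q :: "real \<Rightarrow> real"
  assumes eps: "\<epsilon> * \<epsilon> = 1" and pos: "0 < q (l t)" and range: "l ` A \<subseteq> K"
    and dl: "(l has_real_derivative \<epsilon> * sqrt (q (l t))) (at t within A)"
    and dq: "(q has_real_derivative - 2 * p) (at (l t) within K)"
  shows "((\<lambda>s. \<epsilon> * sqrt (q (l s))) has_real_derivative - p) (at t within A)"
proof -
  have "((\<lambda>s. q (l s)) has_real_derivative - 2 * p * (\<epsilon> * sqrt (q (l t)))) (at t within A)"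
    using DERIV_image_chain[OF DERIV_subset[OF dq range] dl] by (simp add: o_def)
  from DERIV_cmult[OF DERIV_chain2[OF DERIV_real_sqrt[OF pos] this], of \<epsilon>]
  show ?thesis
    by (rule DERIV_cong) (use pos eps in \<open>simp add: field_simps\<close>)
qed

text \<open>
  Along a curve on which \<open>\<eta>\<close> records the sign of \<open>l\<close>, the potential is locally
  \<open>max_moderated Ct (\<eta> t * l s)\<close> with a nonnegative argument, so that the one-sided envelope
  theorem also covers a zero of \<open>l\<close> at an endpoint.
\<close>

lemma moderation_potential_along_curve:
  fixes l \<eta> :: "real \<Rightarrow> real"
  assumes env: "\<And>s. 0 \<le> s \<Longrightarrow> (max_moderated Ct has_real_derivative \<sigma> s) (at s within {0..})"
    and \<eta>: "\<And>s. s \<in> A \<Longrightarrow> \<eta> s * l s = \<bar>l s\<bar>"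
    and loc: "\<forall>\<^sub>F s in at t within A. \<eta> s = \<eta> t" and t: "t \<in> A"
    and dl: "(l has_real_derivative m) (at t within A)"
  shows "((\<lambda>s. moderation_potential Ct (l s)) has_real_derivative \<eta> t * \<sigma> \<bar>l t\<bar> * m) (at t within A)"
proof -
  define B where "B = {s \<in> A. \<eta> s = \<eta> t}"
  have tB: "t \<in> B" using t by (simp add: B_def)
  have same: "at t within A = at t within B"
  proof (rule antisym)
    show "at t within A \<le> at t within B"
      unfolding le_filter_def
    proof (intro allI impI)
      fix Q assume "eventually Q (at t within B)"
      then show "eventually Q (at t within A)"
        using loc unfolding eventually_at_filter by eventually_elim (auto simp: B_def)
    qed
  qed (auto simp: B_def intro: at_le)
  have dl': "((\<lambda>s. \<eta> t * l s) has_real_derivative \<eta> t * m) (at t within B)"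
    using DERIV_cmult[OF dl] unfolding same by simp
  have img: "(\<lambda>s. \<eta> t * l s) ` B \<subseteq> {0..}"
    using \<eta> by (auto simp: B_def) (metis abs_ge_zero)
  have "((\<lambda>s. max_moderated Ct (\<eta> t * l s)) has_real_derivative \<sigma> (\<eta> t * l t) * (\<eta> t * m))
      (at t within B)"
    using DERIV_image_chain[OF DERIV_subset[OF env img] dl'] \<eta>[OF t] by (simp add: o_def)
  then have "((\<lambda>s. moderation_potential Ct (l s)) has_real_derivative \<sigma> (\<eta> t * l t) * (\<eta> t * m))
      (at t within B)"
  proof (rule has_field_derivative_transform_within[OF _ zero_less_one tB])
    show "max_moderated Ct (\<eta> t * l s) = moderation_potential Ct (l s)" if "s \<in> B" for s
      using that \<eta>[of s] by (simp add: B_def moderation_potential_def)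
  qed
  then show ?thesis
    unfolding same using \<eta>[OF t] by (simp add: mult_ac)
qed

theorem proposition3:
  fixes C Ct r r' q l :: "real \<Rightarrow> real"
    and x0 xf v0 vf l0 lf c tf :: real
  assumes C_ge_1: "\<forall>x. 1 \<le> C x"
    and C_C1: "C C1_differentiable_on UNIV"
    and Ct: "moderation_incentive Ct"
    and l0_neq_lf: "l0 \<noteq> lf"
    and q_pos: "\<forall>s\<in>closed_segment l0 lf. 0 < q s"
    and r_deriv: "\<forall>s\<in>closed_segment l0 lf.
          (r has_real_derivative r' s) (at s within closed_segment l0 lf)"
    and r_evolution: "\<forall>s\<in>closed_segment l0 lf.
          q s * r' s + C (r s) - moderation_potential Ct s = c"
    and q_evolution: "\<forall>s\<in>closed_segment l0 lf.
          (q has_real_derivative - 2 * deriv C (r s)) (at s within closed_segment l0 lf)"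
    and r_boundary: "r l0 = x0" "r lf = xf"
    and r'_boundary: "sqrt (q l0) * r' l0 = v0 * sgn (lf - l0)"
          "sqrt (q lf) * r' lf = vf * sgn (lf - l0)"
    and tf_pos: "0 < tf"
    and l_range: "l ` {0..tf} \<subseteq> closed_segment l0 lf"
    and l_ode: "\<forall>t\<in>{0..tf}.
          (l has_real_derivative sgn (lf - l0) * sqrt (q (l t))) (at t within {0..tf})"
    and l_boundary: "l 0 = l0" "l tf = lf"
  shows "synthesis_solution C Ct tf x0 xf v0 vf (r \<circ> l) \<and>
         (c = 0 \<longrightarrow> arbitrary_duration_synthesis_solution C Ct tf x0 xf v0 vf (r \<circ> l))"
proof -
  define \<epsilon> where "\<epsilon> = sgn (lf - l0)"
  define m where "m t = \<epsilon> * sqrt (q (l t))" for t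
  define v where "v t = r' (l t) * m t" for t
  let ?I = "{0..tf}"
  have eps: "\<epsilon> * \<epsilon> = 1" "\<bar>\<epsilon>\<bar> = 1"
    using l0_neq_lf by (auto simp: \<epsilon>_def sgn_if)
  have lK: "l t \<in> closed_segment l0 lf" if "t \<in> ?I" for t
    using l_range that by auto
  have qpos: "0 < q (l t)" if "t \<in> ?I" for t
    using q_pos lK[OF that] by auto
  have m_nz: "m t \<noteq> 0" if "t \<in> ?I" for t
    using qpos[OF that] eps by (auto simp: m_def)
  have dl: "(l has_real_derivative m t) (at t within ?I)" if "t \<in> ?I" for t
    using l_ode that by (simp add: m_def \<epsilon>_def)
  have dm: "(m has_real_derivative - deriv C (r (l t))) (at t within ?I)" if "t \<in> ?I" for t
    using ode_speed_derivative[of \<epsilon> q l t, OF eps(1) qpos[OF that] l_range]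
      dl[OF that] q_evolution lK[OF that] by (simp add: m_def[abs_def])
  have dx: "((r \<circ> l) has_real_derivative v t) (at t within ?I)" if "t \<in> ?I" for t
    using DERIV_image_chain[OF DERIV_subset[OF _ l_range] dl[OF that]] r_deriv lK[OF that]
    by (simp add: v_def)
  have dC: "(C has_real_derivative deriv C y) (at y)" for y
    using C_C1 by (simp add: C1_differentiable_on_eq DERIV_deriv_iff_real_differentiable)
  have law: "v t * m t = c + moderation_potential Ct (l t) - C ((r \<circ> l) t)" if "t \<in> ?I" for t
  proof -
    have "m t * m t = q (l t)"
      using qpos[OF that] eps by (simp add: m_def mult_ac flip: mult.assoc)
    then have "v t * m t = q (l t) * r' (l t)" by (simp add: v_def mult_ac)
    also have "\<dots> = c + moderation_potential Ct (l t) - C ((r \<circ> l) t)"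
      using bspec[OF r_evolution lK[OF that]] by simp
    finally show ?thesis .
  qed

  have cont_l: "continuous_on ?I l" and cont_m: "continuous_on ?I m"
    and cont_x: "continuous_on ?I (r \<circ> l)"
    using DERIV_continuous_on[OF dl] DERIV_continuous_on[OF dm] DERIV_continuous_on[OF dx]
    by blast+

  have cont_\<epsilon>l: "continuous_on ?I (\<lambda>t. \<epsilon> * l t)"
    by (intro continuous_intros cont_l)
  have mono_\<epsilon>l: "strict_mono_on ?I (\<lambda>t. \<epsilon> * l t)"
  proof (rule strict_mono_onI)
    fix s t assume st: "s \<in> ?I" "t \<in> ?I" "s < t"
    show "\<epsilon> * l s < \<epsilon> * l t"
    proof (rule DERIV_pos_imp_increasing_open[OF st(3)])
      fix z assume z: "s < z" "z < t"
      then have "(l has_real_derivative m z) (at z)"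
        using dl[of z] st at_within_Icc_at[of 0 z tf] by auto
      then show "\<exists>d. ((\<lambda>t. \<epsilon> * l t) has_real_derivative d) (at z) \<and> 0 < d"
        using DERIV_cmult[of l "m z" z UNIV \<epsilon>] qpos[of z] st z eps
        by (intro exI[of _ "\<epsilon> * m z"]) (auto simp: m_def simp flip: mult.assoc)
    qed (use st in \<open>auto intro!: continuous_on_subset[OF cont_\<epsilon>l]\<close>)
  qed
  obtain \<theta> S where \<theta>: "\<And>t. \<bar>\<theta> t\<bar> = (1::real)"
    and \<theta>l: "\<And>t. t \<in> ?I \<Longrightarrow> \<theta> t * (\<epsilon> * l t) = \<bar>\<epsilon> * l t\<bar>"
    and S: "finite S" "S \<subseteq> {0<..<tf}"
    and loc: "\<And>t. t \<in> ?I - S \<Longrightarrow> \<forall>\<^sub>F s in at t within ?I. \<theta> s = \<theta> t"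
    and left: "\<And>t. t \<in> S \<Longrightarrow> \<forall>\<^sub>F s in at_left t. \<theta> s = \<theta> t"
    and right: "\<And>t. t \<in> S \<Longrightarrow> \<exists>e. \<forall>\<^sub>F s in at_right t. \<theta> s = e"
    by (rule strict_mono_sign_selector[OF cont_\<epsilon>l mono_\<epsilon>l tf_pos]) (rule that)
  \<comment> \<open>\<open>\<theta>\<close> selects the sign of the increasing function \<open>\<epsilon> * l\<close>, hence \<open>\<theta> * \<epsilon>\<close> that of \<open>l\<close>.\<close>
  define \<eta> where "\<eta> t = \<theta> t * \<epsilon>" for t
  have \<eta>: "\<bar>\<eta> t\<bar> = 1" for t
    using \<theta> eps by (simp add: \<eta>_def abs_mult)
  have \<eta>l: "\<eta> t * l t = \<bar>l t\<bar>" if "t \<in> ?I" for t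
    using \<theta>l[OF that] eps by (simp add: \<eta>_def abs_mult mult_ac)

  have contC: "continuous_on {0..1} Ct"
    using Ct by (simp add: moderation_incentive_def)
  obtain \<sigma> where \<sigma>: "continuous_on {0..} \<sigma>" "\<And>s. 0 \<le> s \<Longrightarrow> \<sigma> s \<in> {0..1}"
    "\<And>s. 0 \<le> s \<Longrightarrow> \<sigma> s * s + Ct (\<sigma> s) = max_moderated Ct s"
    by (rule moderation_incentive_level[OF Ct]) (rule that)
  note env = max_moderated_envelope[OF contC \<sigma>]
  have cont_\<sigma>l: "continuous_on ?I (\<lambda>t. \<sigma> \<bar>l t\<bar>)"
    by (rule continuous_on_compose2[OF \<sigma>(1)]) (auto intro!: continuous_intros cont_l)
  define u where "u t = \<eta> t * \<sigma> \<bar>l t\<bar>" for t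
  have abs_u: "\<bar>u t\<bar> = \<sigma> \<bar>l t\<bar>" for t
    using \<sigma>(2)[of "\<bar>l t\<bar>"] \<eta>[of t] by (simp add: u_def abs_mult)

  have dv: "(v has_real_derivative u t) (at t within ?I)" if t: "t \<in> ?I - S" for t
  proof (rule conservation_law_derivative[OF law m_nz _ dx dm])
    show "((\<lambda>t. moderation_potential Ct (l t)) has_real_derivative u t * m t) (at t within ?I)"
      unfolding u_def
      by (rule moderation_potential_along_curve[OF env \<eta>l _ _ dl])
        (use t loc[OF t] in \<open>auto simp: \<eta>_def elim!: eventually_mono\<close>)
  qed (use t dC in auto)

  have cont_v: "continuous_on ?I v"
  proof -
    have "continuous_on {0..} (max_moderated Ct)"
      by (rule DERIV_continuous_on[OF env]) auto
    then have "continuous_on ?I (\<lambda>t. moderation_potential Ct (l t))"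
      unfolding moderation_potential_def
      by (rule continuous_on_compose2) (auto intro!: continuous_intros cont_l)
    moreover have "continuous_on ?I (\<lambda>t. C ((r \<circ> l) t))"
      using dC by (intro continuous_on_compose2[OF _ cont_x, of UNIV C])
        (auto intro: DERIV_isCont continuous_at_imp_continuous_on)
    ultimately have
      "continuous_on ?I (\<lambda>t. (c + moderation_potential Ct (l t) - C ((r \<circ> l) t)) / m t)"
      using m_nz by (intro continuous_intros cont_m) auto
    moreover have "(c + moderation_potential Ct (l t) - C ((r \<circ> l) t)) / m t = v t"
      if "t \<in> ?I" for t
      using law[OF that] m_nz[OF that] by (simp add: field_simps)
    ultimately show ?thesis
      by (rule continuous_on_eq)
  qed

  \<comment> \<open>Where \<open>\<theta>\<close> is eventually constant, \<open>u\<close> is eventually a constant multiple of the continuous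
    \<open>\<sigma> \<bar>l\<bar>\<close>.\<close>
  have u_limit: "(u \<longlongrightarrow> e * \<epsilon> * \<sigma> \<bar>l t\<bar>) (at t within A)"
    if "t \<in> ?I" "at t within A \<le> at t within ?I" "\<forall>\<^sub>F s in at t within A. \<theta> s = e" for t A e
  proof (rule Lim_transform_eventually)
    have "((\<lambda>s. \<sigma> \<bar>l s\<bar>) \<longlongrightarrow> \<sigma> \<bar>l t\<bar>) (at t within A)"
      using cont_\<sigma>l that(1,2) by (auto simp: continuous_on_def intro: tendsto_mono)
    then show "((\<lambda>s. e * \<epsilon> * \<sigma> \<bar>l s\<bar>) \<longlongrightarrow> e * \<epsilon> * \<sigma> \<bar>l t\<bar>) (at t within A)"
      by (intro tendsto_intros)
    show "\<forall>\<^sub>F s in at t within A. e * \<epsilon> * \<sigma> \<bar>l s\<bar> = u s"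
      using that(3) by eventually_elim (simp add: u_def \<eta>_def)
  qed
  have cont_u: "continuous_on (?I - S) u"
    unfolding continuous_on_def
  proof
    fix t assume t: "t \<in> ?I - S"
    have "(u \<longlongrightarrow> \<theta> t * \<epsilon> * \<sigma> \<bar>l t\<bar>) (at t within ?I)"
      using t loc[OF t] by (intro u_limit) auto
    then show "(u \<longlongrightarrow> u t) (at t within ?I - S)"
      unfolding u_def \<eta>_def by (rule tendsto_within_subset) auto
  qed
  have u_sides: "(u \<longlongrightarrow> u t) (at_left t) \<and> (\<exists>e. (u \<longlongrightarrow> e) (at_right t))" if t: "t \<in> S" for t
  proof -
    have in_I: "0 < t" "t < tf" using S t by auto
    have full: "at t within ?I = at t"
      using in_I by (simp add: at_within_Icc_at)
    obtain e where e: "\<forall>\<^sub>F s in at_right t. \<theta> s = e" using right[OF t] by blast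
    show ?thesis
      using u_limit[of t "{..<t}" "\<theta> t"] u_limit[of t "{t<..}" e] left[OF t] e in_I
      by (auto simp: full at_le u_def \<eta>_def)
  qed

  have C1: "C1_piecewise_C2 tf (r \<circ> l) v u"
    unfolding C1_piecewise_C2_def
    by (intro conjI ballI exI[of _ S] dx cont_v S dv cont_u)
      (auto dest: u_sides)
  have curve: "synthesis_curve C Ct tf (r \<circ> l) v u l m"
    unfolding synthesis_curve_def
  proof (intro conjI ballI tf_pos C1)
    fix t assume t: "t \<in> ?I"
    show "\<bar>u t\<bar> \<le> 1"
      using \<sigma>(2)[of "\<bar>l t\<bar>"] by (simp add: abs_u)
    show "(l has_real_derivative m t) (at t within ?I)"
      by (rule dl[OF t])
    show "(m has_real_derivative - deriv C ((r \<circ> l) t)) (at t within ?I)"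
      using dm[OF t] by simp
    show "\<bar>u t\<bar> * \<bar>l t\<bar> + Ct \<bar>u t\<bar> = moderation_potential Ct (l t)"
      using \<sigma>(3)[of "\<bar>l t\<bar>"] by (simp add: abs_u moderation_potential_def)
    have "\<bar>l t\<bar> * \<eta> t = l t"
      using \<eta>l[OF t] \<eta>[of t] by (auto simp: abs_if split: if_splits)
    then show "\<bar>l t\<bar> * u t = \<bar>u t\<bar> * l t"
      unfolding abs_u unfolding u_def by (simp flip: mult.assoc)
  qed
  have v_ends: "v 0 = v0" "v tf = vf"
    using r'_boundary eps by (simp_all add: v_def m_def l_boundary \<epsilon>_def[symmetric] mult_ac)
  have ends: "(r \<circ> l) 0 = x0" "(r \<circ> l) tf = xf"
    using r_boundary l_boundary by auto
  have "synthesis_solution C Ct tf x0 xf v0 vf (r \<circ> l)"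
    unfolding synthesis_solution_def
    by (rule exI[of _ v], rule exI[of _ u], rule exI[of _ l], rule exI[of _ m])
      (intro conjI curve ends v_ends)
  moreover have "arbitrary_duration_synthesis_solution C Ct tf x0 xf v0 vf (r \<circ> l)" if "c = 0"
  proof -
    have zero: "\<forall>t\<in>?I. moderation_potential Ct (l t) - C ((r \<circ> l) t) - v t * m t = 0"
      using law that by simp
    show ?thesis
      unfolding arbitrary_duration_synthesis_solution_def
      by (rule exI[of _ v], rule exI[of _ u], rule exI[of _ l], rule exI[of _ m])
        (intro conjI curve ends v_ends zero)
  qed
  ultimately show ?thesis by blast
qed

end
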